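(* Let $\mathcal A \subset \mathbb{R}$ be a finite, non-empty set such that $|\mathcal A+ \mathcal A|/|\mathcal A| = K$ for some $K \geq 1$. Then \[ K^{-3}|\mathcal A|^{10} \ll \mathfrak{C}_3(\mathcal A) \ll K^6 |\mathcal A|^{10} (\log (2|\mathcal A|))^3, \] where the implied constants are absolute.
   Context: $\mathcal A+\mathcal A=\{a+b: a,b\in\mathcal A\}$. For a finite set $\mathcal A\subset\mathbb{R}$, $\mathfrak{C}_3(\mathcal A)$ denotes the number of pairs $(A,B)$ of $3\times 3$ matrices, all of whose entries lie in $\mathcal A$, such that $AB=BA$. *)

theory Defs
  imports "HOL-Analysis.Analysis" "HOL-Library.Numeral_Type"
begin

definition sumset :: "real set \<Rightarrow> real set" where
  "sumset S = {a + b | a b. a \<in> S \<and> b \<in> S}"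

definition entries_in :: "real set \<Rightarrow> real^3^3 \<Rightarrow> bool" where
  "entries_in S M \<longleftrightarrow> (\<forall>i j. M $ i $ j \<in> S)"

definition C3 :: "real set \<Rightarrow> nat" where
  "C3 S = card {p :: (real^3^3) \<times> (real^3^3).
                 entries_in S (fst p) \<and> entries_in S (snd p) \<and> fst p ** snd p = snd p ** fst p}"

end

theory Submission
  imports Defs
begin

text \<open>
  Write \<open>n = |S|\<close> and \<open>m = |S + S| = K n\<close>.

  Lower bound: \<open>A\<close> commutes with \<open>A + t I\<close>, so it suffices to count triples of pairs with equal
  differences. If \<open>r t\<close> is the number of representations of \<open>t\<close> as a difference, Cauchy-Schwarz gives
  \<open>\<Sum> r\<^sup>2 \<ge> n\<^sup>4 / m\<close>, because the additive energy can be computed with sums, and then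
  \<open>\<Sum> r\<^sup>3 \<ge> n\<^sup>6 / m\<^sup>2\<close>. The six off-diagonal entries of \<open>A\<close> are free.

  Upper bound: the diagonal entries of \<open>A B = B A\<close> say that
  \<open>a\<^sub>i\<^sub>j b\<^sub>j\<^sub>i - b\<^sub>i\<^sub>j a\<^sub>j\<^sub>i\<close> takes the same value \<open>t\<close> for \<open>ij = 12, 23, 31\<close>. Each such equation has at
  most \<open>E\<close> solutions, where \<open>E\<close> is the multiplicative energy of \<open>S\<close>. If \<open>t \<noteq> 0\<close>, the off-diagonal
  entries of \<open>A B = B A\<close> determine the diagonals up to the choice of one diagonal pair, which leaves
  \<open>n\<^sup>4 E\<^sup>2 n\<^sup>2\<close> possibilities. If \<open>t = 0\<close>, there are \<open>E\<^sup>3\<close> off-diagonal parts, and \<open>n\<^sup>4\<close> diagonals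
  for each of them unless two of the three off-diagonal blocks vanish, which leaves at most \<open>n\<^sup>1\<^sup>0\<close> pairs.
  Finally \<open>E = O(m\<^sup>2 log (2 n))\<close> by Solymosi's argument on slopes, run in the half-plane \<open>x > 0\<close>.
\<close>

section \<open>Counting by fibers and collisions\<close>

lemma card_eq_sum_fibers:
  assumes "finite A" "finite V" "g ` A \<subseteq> V"
  shows "card A = (\<Sum>v\<in>V. card {x\<in>A. g x = v})"
  using sum.group[OF assms, of "\<lambda>_. 1::nat"] by simp

lemma card_le_fibers:
  assumes "finite A" "finite V" "g ` A \<subseteq> V" "\<And>v. v \<in> V \<Longrightarrow> card {x\<in>A. g x = v} \<le> k"
  shows "card A \<le> card V * k"
  using card_eq_sum_fibers[OF assms(1-3)] sum_bounded_above[of V "\<lambda>v. card {x\<in>A. g x = v}" k] assms(4)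
  by simp

lemma card_collisions:
  assumes "finite A" "finite V" "f ` A \<subseteq> V"
  shows "card {(x,y). x \<in> A \<and> y \<in> A \<and> f x = f y} = (\<Sum>v\<in>V. (card {x\<in>A. f x = v})\<^sup>2)"
proof -
  let ?C = "{(x,y). x \<in> A \<and> y \<in> A \<and> f x = f y}"
  have "finite ?C" by (rule finite_subset[of _ "A \<times> A"]) (use assms in auto)
  then have "card ?C = (\<Sum>v\<in>V. card {p\<in>?C. f (fst p) = v})"
    by (rule card_eq_sum_fibers) (use assms in auto)
  also have "\<dots> = (\<Sum>v\<in>V. card ({x\<in>A. f x = v} \<times> {x\<in>A. f x = v}))"
    by (intro sum.cong refl arg_cong[of _ _ card]) auto
  finally show ?thesis by (simp add: card_cartesian_product power2_eq_square)
qed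

lemma card_triple_collisions:
  assumes "finite A" "finite V" "f ` A \<subseteq> V"
  shows "card {(x,y,z). x \<in> A \<and> y \<in> A \<and> z \<in> A \<and> f x = f y \<and> f y = f z}
    = (\<Sum>v\<in>V. (card {x\<in>A. f x = v})^3)"
proof -
  let ?C = "{(x,y,z). x \<in> A \<and> y \<in> A \<and> z \<in> A \<and> f x = f y \<and> f y = f z}"
  have "finite ?C" by (rule finite_subset[of _ "A \<times> A \<times> A"]) (use assms in auto)
  then have "card ?C = (\<Sum>v\<in>V. card {p\<in>?C. f (fst p) = v})"
    by (rule card_eq_sum_fibers) (use assms in auto)
  also have "\<dots> = (\<Sum>v\<in>V. card ({x\<in>A. f x = v} \<times> {x\<in>A. f x = v} \<times> {x\<in>A. f x = v}))"
    by (intro sum.cong refl arg_cong[of _ _ card]) auto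
  finally show ?thesis by (simp add: card_cartesian_product power3_eq_cube mult.assoc)
qed

text \<open>With fiber sizes \<open>m v\<close>, the left side is the autocorrelation of
  \<open>m\<close> at shift \<open>t\<close>. By 2ab \<le> a^2 + b^2 it is at most its value at
  shift 0.\<close>

lemma card_shifted_collisions_le:
  fixes f :: "'a \<Rightarrow> real"
  assumes "finite A"
  shows "card {(x,y). x \<in> A \<and> y \<in> A \<and> f x - f y = t} \<le> card {(x,y). x \<in> A \<and> y \<in> A \<and> f x = f y}"
proof -
  define m where "m v = card {x\<in>A. f x = v}" for v
  define V where "V = f ` A"
  have fV: "finite V" using assms by (simp add: V_def)
  have m0: "m v = 0" if "v \<notin> V" for v
  proof -
    have "{x\<in>A. f x = v} = {}" using that by (auto simp: V_def)
    then show ?thesis unfolding m_def by (metis card.empty)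
  qed
  let ?C = "{(x,y). x \<in> A \<and> y \<in> A \<and> f x - f y = t}"
  have "finite ?C" by (rule finite_subset[of _ "A \<times> A"]) (use assms in auto)
  then have "card ?C = (\<Sum>v\<in>V. card {p\<in>?C. f (fst p) = v})"
    by (rule card_eq_sum_fibers) (use assms in \<open>auto simp: V_def\<close>)
  also have "\<dots> = (\<Sum>v\<in>V. card ({x\<in>A. f x = v} \<times> {x\<in>A. f x = v - t}))"
    by (intro sum.cong refl arg_cong[of _ _ card]) auto
  finally have c: "card ?C = (\<Sum>v\<in>V. m v * m (v - t))"
    by (simp add: card_cartesian_product m_def)
  \<comment> \<open>Doubling keeps the inequality 2ab \<le> a^2 + b^2 inside the naturals.\<close>
  have "2 * (\<Sum>v\<in>V. m v * m (v - t)) = (\<Sum>v\<in>V. 2 * m v * m (v - t))"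
    by (simp add: sum_distrib_left mult.assoc)
  also have "\<dots> \<le> (\<Sum>v\<in>V. (m v)\<^sup>2 + (m (v - t))\<^sup>2)"
  proof (rule sum_mono)
    fix v
    have "2 * real (m v) * real (m (v - t)) \<le> real (m v)^2 + real (m (v-t))^2"
      by (rule sum_squares_bound)
    then show "2 * m v * m (v - t) \<le> (m v)\<^sup>2 + (m (v - t))\<^sup>2"
      by (metis (mono_tags, lifting) of_nat_add of_nat_le_iff of_nat_mult of_nat_numeral of_nat_power)
  qed
  also have "\<dots> = (\<Sum>v\<in>V. (m v)\<^sup>2) + (\<Sum>v\<in>V. (m (v - t))\<^sup>2)"
    by (rule sum.distrib)
  \<comment> \<open>Translating the index by \<open>t\<close> may leave \<open>V\<close>, but
    \<open>m\<close> vanishes outside \<open>V\<close>, so the shifted sum is bounded by the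
    original one.\<close>
  also have "(\<Sum>v\<in>V. (m (v - t))\<^sup>2) = (\<Sum>v\<in>(\<lambda>v. v - t) ` V. (m v)\<^sup>2)"
    by (subst sum.reindex) (auto simp: inj_on_def)
  also have "\<dots> = (\<Sum>v\<in>(\<lambda>v. v - t) ` V \<inter> V. (m v)\<^sup>2)"
    by (rule sum.mono_neutral_right) (use fV m0 in auto)
  also have "\<dots> \<le> (\<Sum>v\<in>V. (m v)\<^sup>2)"
    by (rule sum_mono2) (use fV in auto)
  finally have "card ?C \<le> (\<Sum>v\<in>V. (m v)\<^sup>2)" using c by simp
  then show ?thesis
    using card_collisions[OF assms fV, of f] by (simp add: m_def V_def)
qed

section \<open>Basic facts on sumsets\<close>

lemma finite_sumset: "finite X \<Longrightarrow> finite (sumset X)"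
  by (rule finite_subset[of _ "(\<lambda>(a,b). a + b) ` (X \<times> X)"]) (auto simp: sumset_def)

lemma add_mem_sumset: "a \<in> S \<Longrightarrow> b \<in> S \<Longrightarrow> a + b \<in> sumset S"
  by (auto simp: sumset_def)

lemma sumset_mono: "X \<subseteq> Y \<Longrightarrow> sumset X \<subseteq> sumset Y"
  by (auto simp: sumset_def)

lemma card_le_card_sumset:
  assumes "finite X" shows "card X \<le> card (sumset X)"
proof (cases "X = {}")
  case False
  then obtain a where a: "a \<in> X" by auto
  have "card X = card ((+) a ` X)" by (simp add: card_image)
  also have "\<dots> \<le> card (sumset X)"
    by (rule card_mono) (use a finite_sumset[OF assms] in \<open>auto simp: sumset_def\<close>)
  finally show ?thesis .
qed simp

text \<open>Negative elements are later handled by reflecting \<open>S\<close>; this keeps the same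
  sumset bound available for the reflected set.\<close>

lemma card_sumset_uminus: "card (sumset (uminus ` X)) = card (sumset X)"
proof -
  have "sumset (uminus ` X) = uminus ` sumset X"
  proof (intro set_eqI iffI)
    fix x assume "x \<in> sumset (uminus ` X)"
    then obtain a b where "a \<in> X" "b \<in> X" "x = - (a + b)" by (auto simp: sumset_def)
    then show "x \<in> uminus ` sumset X" unfolding sumset_def by blast
  next
    fix x assume "x \<in> uminus ` sumset X"
    then obtain a b where "a \<in> X" "b \<in> X" "x = - a + - b" by (auto simp: sumset_def)
    then show "x \<in> sumset (uminus ` X)" unfolding sumset_def by blast
  qed
  then show ?thesis by (simp add: card_image)
qed

section \<open>Rich slopes and Solymosi's argument\<close>

text \<open>Vectors on two consecutive rays of slopes \<open>p < q\<close> have pairwise distinct sums, and these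
  sums lie strictly between the two rays.\<close>
lemma rich_slopes_below_Max:
  fixes X Y L :: "real set"
  assumes X: "finite X" "\<And>x. x \<in> X \<Longrightarrow> 0 < x" and Y: "finite Y"
    and L: "finite L" "L \<noteq> {}" and rich: "\<And>q. q \<in> L \<Longrightarrow> \<tau> \<le> card {x\<in>X. q * x \<in> Y}"
  shows "(card L - 1) * \<tau>\<^sup>2 \<le> card {(u,v). u \<in> sumset X \<and> v \<in> sumset Y \<and> v < Max L * u}"
  using L rich
\<comment> \<open>Slopes are added in increasing order. The first contributes nothing; each later
  slope \<open>b\<close>, paired with the previous maximum \<open>p\<close>, adds at least
  \<open>\<tau>\<^sup>2\<close> sums lying in \<open>?U b\<close> but outside
  \<open>?U p\<close>.\<close>
proof (induction L rule: finite_linorder_max_induct)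
  case (insert b L)
  let ?U = "\<lambda>q. {(u,v). u \<in> sumset X \<and> v \<in> sumset Y \<and> v < q * u}"
  have finU: "finite (?U q)" for q
    by (rule finite_subset[of _ "sumset X \<times> sumset Y"]) (use finite_sumset X Y in auto)
  show ?case
  proof (cases "L = {}")
    case False
    define p where "p = Max L"
    have pL: "p \<in> L" and pb: "p < b" using insert False by (auto simp: p_def)
    define R where "R q = {x\<in>X. q * x \<in> Y}" for q
    define h where "h = (\<lambda>(x, y). (x + y, p * x + b * y))"
    have spos: "u > 0" if "u \<in> sumset X" for u
    proof -
      obtain a b where "a \<in> X" "b \<in> X" "u = a + b" using \<open>u \<in> sumset X\<close> by (auto simp: sumset_def)
      then show ?thesis using X(2)[of a] X(2)[of b] by simp
    qed
    have "inj_on h (R p \<times> R b)"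
    proof (rule inj_onI, clarsimp simp: h_def)
      fix x y x' y' assume 1: "x + y = x' + y'" "p * x + b * y = p * x' + b * y'"
      then have "x = x' + y' - y" by simp
      with 1(2) have "p * (x' + y' - y) + b * y = p * x' + b * y'" by simp
      then have "(b - p) * (y - y') = 0" by (simp add: algebra_simps)
      then show "x = x' \<and> y = y'" using pb 1 by simp
    qed
    then have c: "card (h ` (R p \<times> R b)) = card (R p) * card (R b)"
      by (simp add: card_image card_cartesian_product)
    have sub: "h ` (R p \<times> R b) \<subseteq> ?U b"
    proof clarsimp
      fix x y u v assume "x \<in> R p" "y \<in> R b" "(u, v) = h (x, y)"
      moreover from this have "p * x < b * x" using pb X(2) by (auto simp: R_def)
      ultimately show "u \<in> sumset X \<and> v \<in> sumset Y \<and> v < b * u"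
        by (auto simp: R_def h_def sumset_def algebra_simps)
    qed
    have disj: "h ` (R p \<times> R b) \<inter> ?U p = {}"
    proof -
      have "\<not> p * x + b * y < p * (x + y)" if "y \<in> R b" for x y
      proof -
        have "p * y < b * y" using pb X(2) that by (auto simp: R_def)
        then show ?thesis by (simp add: algebra_simps)
      qed
      then show ?thesis by (auto simp: h_def)
    qed
    have sub': "?U p \<subseteq> ?U b"
    proof clarsimp
      fix u v assume "u \<in> sumset X" "v < p * u"
      moreover have "p * u < b * u" using pb spos[OF \<open>u \<in> sumset X\<close>] by simp
      ultimately show "v < b * u" by simp
    qed
    have "b \<notin> L" using insert by auto
    then have "card (insert b L) - 1 = (card L - 1) + 1"
      using insert.hyps(1) False by (simp add: card_gt_0_iff Suc_leI)
    then have "(card (insert b L) - 1) * \<tau>\<^sup>2 = (card L - 1) * \<tau>\<^sup>2 + \<tau> * \<tau>"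
      by (simp add: power2_eq_square)
    also have "\<dots> \<le> card (?U p) + card (R p) * card (R b)"
      using insert.IH[OF False] insert.prems pL
      by (intro add_mono mult_mono) (auto simp: p_def R_def)
    also have "\<dots> = card (?U p \<union> h ` (R p \<times> R b))"
      using c disj finU X by (subst card_Un_disjoint) (auto simp: R_def)
    also have "\<dots> \<le> card (?U b)"
      by (rule card_mono[OF finU]) (use sub sub' in auto)
    finally have "(card (insert b L) - 1) * \<tau>\<^sup>2 \<le> card (?U b)" .
    moreover have "Max (insert b L) = b"
      using insert.hyps by (intro Max_eqI) auto
    ultimately show ?thesis by simp
  qed simp
qed simp

text \<open>The slope missing from \<open>card L - 1\<close> is recovered from \<tau> \<le>
  \<open>card X\<close> \<le> m, at the price of the factor 2.\<close>

lemma card_rich_slopes_le: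
  fixes X Y L :: "real set"
  assumes X: "finite X" "\<And>x. x \<in> X \<Longrightarrow> 0 < x" and Y: "finite Y"
    and L: "finite L" and rich: "\<And>q. q \<in> L \<Longrightarrow> \<tau> \<le> card {x\<in>X. q * x \<in> Y}"
    and m: "card (sumset X) \<le> m" "card (sumset Y) \<le> m"
  shows "card L * \<tau>\<^sup>2 \<le> 2 * m\<^sup>2"
proof (cases "L = {}")
  case False
  then obtain q where q: "q \<in> L" by auto
  have "card {x\<in>X. q * x \<in> Y} \<le> card X" using X by (intro card_mono) auto
  then have "\<tau> \<le> m" using rich[OF q] card_le_card_sumset[OF X(1)] m by linarith
  then have 1: "\<tau>\<^sup>2 \<le> m\<^sup>2" by (simp add: power_mono)
  have "card {(u,v). u \<in> sumset X \<and> v \<in> sumset Y \<and> v < Max L * u} \<le> card (sumset X \<times> sumset Y)"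
    by (rule card_mono) (use finite_sumset X Y in auto)
  also have "\<dots> \<le> m * m" using m by (simp add: card_cartesian_product mult_mono)
  finally have 2: "(card L - 1) * \<tau>\<^sup>2 \<le> m\<^sup>2"
    using rich_slopes_below_Max[OF X Y L False rich] by (simp add: power2_eq_square)
  have "card L = Suc (card L - 1)" using L False by (simp add: card_gt_0_iff)
  then have "card L * \<tau>\<^sup>2 = (card L - 1) * \<tau>\<^sup>2 + \<tau>\<^sup>2" by (metis add.commute mult_Suc)
  then show ?thesis using 1 2 by linarith
qed simp

text \<open>Layer-cake summation: k^2 \<le> k(k+1) is the sum of 2\<tau> over \<tau> = 1..k, and
  exchanging the order of summation turns squares into counts of superlevel sets.\<close>

lemma sum_power2_le_sum_thresholds:
  fixes r :: "'a \<Rightarrow> nat"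
  assumes "finite Q" "\<And>q. q \<in> Q \<Longrightarrow> r q \<le> n"
  shows "(\<Sum>q\<in>Q. (r q)\<^sup>2) \<le> (\<Sum>\<tau>=1..n. 2 * \<tau> * card {q\<in>Q. \<tau> \<le> r q})"
proof -
  have sq: "k\<^sup>2 \<le> (\<Sum>\<tau>=1..k. 2 * \<tau>)" for k :: nat
    by (induction k) (auto simp: power2_eq_square)
  have "(\<Sum>q\<in>Q. (r q)\<^sup>2) \<le> (\<Sum>q\<in>Q. \<Sum>\<tau>=1..n. if \<tau> \<le> r q then 2 * \<tau> else 0)"
  proof (rule sum_mono)
    fix q assume "q \<in> Q"
    have "(r q)\<^sup>2 \<le> (\<Sum>\<tau>=1..r q. 2 * \<tau>)" by (rule sq)
    also have "\<dots> = (\<Sum>\<tau>=1..n. if \<tau> \<le> r q then 2 * \<tau> else 0)"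
      using assms(2)[OF \<open>q \<in> Q\<close>] by (intro sum.mono_neutral_cong_left) auto
    finally show "(r q)\<^sup>2 \<le> \<dots>" .
  qed
  also have "\<dots> = (\<Sum>\<tau>=1..n. \<Sum>q\<in>Q. if \<tau> \<le> r q then 2 * \<tau> else 0)" by (rule sum.swap)
  also have "\<dots> = (\<Sum>\<tau>=1..n. 2 * \<tau> * card {q\<in>Q. \<tau> \<le> r q})"
    using assms(1) by (intro sum.cong refl) (simp add: sum.If_cases Int_def mult.commute)
  finally show ?thesis .
qed

text \<open>At most 2m^2/\<tau>^2 slopes are \<tau>-rich, so the threshold \<tau> contributes at
  most 4m^2/\<tau>; the logarithm is the resulting harmonic sum.\<close>

lemma sum_slopes_power2_le:
  fixes X Y Q :: "real set"
  assumes X: "finite X" "\<And>x. x \<in> X \<Longrightarrow> 0 < x" and Y: "finite Y" and Q: "finite Q"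
    and m: "card (sumset X) \<le> m" "card (sumset Y) \<le> m" and n: "card X \<le> n" "0 < n"
  shows "real (\<Sum>q\<in>Q. (card {x\<in>X. q * x \<in> Y})\<^sup>2) \<le> 4 * (real m)\<^sup>2 * (1 + ln (real n))"
proof -
  define r where "r q = card {x\<in>X. q * x \<in> Y}" for q
  have rn: "r q \<le> n" for q
    using card_mono[OF X(1), of "{x\<in>X. q * x \<in> Y}"] n by (auto simp: r_def)
  have "real (\<Sum>q\<in>Q. (r q)\<^sup>2) \<le> real (\<Sum>\<tau>=1..n. 2 * \<tau> * card {q\<in>Q. \<tau> \<le> r q})"
    by (intro of_nat_mono sum_power2_le_sum_thresholds Q rn)
  also have "\<dots> = (\<Sum>\<tau>=1..n. 2 * real \<tau> * card {q\<in>Q. \<tau> \<le> r q})" by simp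
  also have "\<dots> \<le> (\<Sum>\<tau>=1..n. 4 * (real m)\<^sup>2 * inverse (real \<tau>))"
  proof (rule sum_mono)
    fix \<tau> assume "\<tau> \<in> {1..n}"
    have "card {q\<in>Q. \<tau> \<le> r q} * \<tau>\<^sup>2 \<le> 2 * m\<^sup>2"
      by (rule card_rich_slopes_le[OF X Y _ _ m]) (use Q in \<open>auto simp: r_def\<close>)
    then have "real (card {q\<in>Q. \<tau> \<le> r q}) * (real \<tau>)\<^sup>2 \<le> 2 * (real m)\<^sup>2"
      by (metis (mono_tags, lifting) of_nat_le_iff of_nat_mult of_nat_numeral of_nat_power)
    then show "2 * real \<tau> * card {q\<in>Q. \<tau> \<le> r q} \<le> 4 * (real m)\<^sup>2 * inverse (real \<tau>)"
      using \<open>\<tau> \<in> {1..n}\<close> by (simp add: field_simps power2_eq_square)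
  qed
  also have "\<dots> = 4 * (real m)\<^sup>2 * harm n" by (simp add: harm_def sum_distrib_left)
  \<comment> \<open>The sequence \<open>harm n - ln n\<close> decreases from its value 1 at n =
    1.\<close>
  also have "\<dots> \<le> 4 * (real m)\<^sup>2 * (1 + ln (real n))"
    using euler_mascheroni_sequence_decreasing[of 1 n] n
    by (intro mult_left_mono) (auto simp: harm_def)
  finally show ?thesis by (simp add: r_def)
qed

section \<open>Bounding the multiplicative energy\<close>

definition mult_energy :: "real set \<Rightarrow> nat" where
  "mult_energy S = card {(x,y). x \<in> S \<times> S \<and> y \<in> S \<times> S \<and> fst x * snd x = fst y * snd y}"

lemma card_div_eq_le:
  fixes S :: "real set"
  assumes S: "finite S"
  shows "card {x \<in> S \<times> (S - {0}). fst x / snd x = q}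
    \<le> card {c \<in> {s\<in>S. 0 < s}. q * c \<in> S} + card {c \<in> {s\<in>uminus ` S. 0 < s}. q * c \<in> uminus ` S}"
proof -
  let ?P = "{c \<in> {s\<in>S. 0 < s}. q * c \<in> S}"
  let ?N = "{c \<in> {s\<in>uminus ` S. 0 < s}. q * c \<in> uminus ` S}"
  have "{x \<in> S \<times> (S - {0}). fst x / snd x = q} \<subseteq> (\<lambda>c. (q * c, c)) ` (?P \<union> uminus ` ?N)"
  proof (rule subsetI)
    fix x assume x: "x \<in> {x \<in> S \<times> (S - {0}). fst x / snd x = q}"
    define c where "c = snd x"
    have x: "x = (q * c, c)" and c: "c \<in> S" "q * c \<in> S" "c \<noteq> 0"
      using x by (cases x; force simp: c_def)+
    have "c \<in> ?P \<union> uminus ` ?N"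
    proof (cases "0 < c")
      case False
      then have "- c \<in> ?N" using c by (auto simp: image_iff)
      then show ?thesis by (metis (no_types, lifting) UnI2 add.inverse_inverse image_eqI)
    qed (use c in auto)
    then show "x \<in> (\<lambda>c. (q * c, c)) ` (?P \<union> uminus ` ?N)" unfolding x by (rule imageI)
  qed
  then have "card {x \<in> S \<times> (S - {0}). fst x / snd x = q} \<le> card (?P \<union> uminus ` ?N)"
    by (rule surj_card_le[rotated]) (use S in simp)
  also have "\<dots> \<le> card ?P + card (uminus ` ?N)" by (rule card_Un_le)
  also have "card (uminus ` ?N) = card ?N" by (simp add: card_image)
  finally show ?thesis by simp
qed

lemma card_mult_eq_0_le:
  fixes S :: "real set"
  assumes "finite S"
  shows "card {x \<in> S \<times> S. fst x * snd x = 0} \<le> 2 * card S"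
proof -
  have "card {x \<in> S \<times> S. fst x * snd x = 0} \<le> card (({0} \<times> S) \<union> (S \<times> {0}))"
    using assms by (intro card_mono) auto
  also have "\<dots> \<le> card ({0::real} \<times> S) + card (S \<times> {0::real})" by (rule card_Un_le)
  finally show ?thesis by (simp add: card_cartesian_product)
qed

text \<open>Solymosi's bound. Zeros are harmless, and \<open>a b = c d\<close> says that \<open>(c,a)\<close> and \<open>(b,d)\<close> lie on a
  common line through the origin.\<close>
lemma mult_energy_le:
  assumes S: "finite S" "S \<noteq> {}"
  shows "real (mult_energy S) \<le> 40 * (real (card (sumset S)))\<^sup>2 * ln (2 * real (card S))"
proof -
  define n where "n = card S"
  define m where "m = card (sumset S)"
  have n: "0 < n" and nm: "n \<le> m" using S card_le_card_sumset by (auto simp: n_def m_def card_gt_0_iff)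
  define F where "F = S \<times> (S - {0})"
  define Q where "Q = (\<lambda>x. fst x / snd x) ` F"
  define Z where "Z = {x \<in> S \<times> S. fst x * snd x = 0}"
  let ?C = "{(x,y). x \<in> F \<and> y \<in> F \<and> fst x / snd x = fst y / snd y}"
  let ?h = "\<lambda>((a,c),(d,b)). ((a,b),(c,d)) :: (real \<times> real) \<times> (real \<times> real)"
  let ?E = "{(x,y). x \<in> S \<times> S \<and> y \<in> S \<times> S \<and> fst x * snd x = fst y * snd y}"
  let ?U1 = "(\<lambda>(x, d). (x, (0::real, d))) ` (Z \<times> S)" and ?U2 = "(\<lambda>(a, y). ((a, 0::real), y)) ` (S \<times> Z)"
  have fin: "finite F" "finite Q" "finite Z" using S by (auto simp: F_def Q_def Z_def)
  have finC: "finite ?C" by (rule finite_subset[of _ "F \<times> F"]) (use fin in auto)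
  \<comment> \<open>For ab = cd only c and b become denominators, in a/c = d/b. If c = 0 then ab =
    0, giving \<open>?U1\<close>; if b = 0 then cd = 0, giving \<open>?U2\<close>. Each exceptional
    family has at most 2n^2 members.\<close>
  have sub: "?E \<subseteq> ?U1 \<union> ?U2 \<union> ?h ` ?C"
  proof (rule subsetI, rule ccontr)
    fix z assume z: "z \<in> ?E" "z \<notin> ?U1 \<union> ?U2 \<union> ?h ` ?C"
    obtain a b c d where zz: "z = ((a,b),(c,d))" by (metis surj_pair)
    have 1: "((a,b),(c,d)) \<notin> ?h ` ?C" "((a,b),(c,d)) \<notin> ?U2" "((a,b),(c,d)) \<notin> ?U1"
      using z(2) unfolding zz by blast+
    have 2: "a \<in> S" "b \<in> S" "c \<in> S" "d \<in> S" "a * b = c * d" using z(1) zz by auto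
    have "c = 0"
    proof (rule ccontr)
      assume "c \<noteq> 0"
      have "b \<noteq> 0"
      proof
        assume "b = 0"
        then have "((a,b),(c,d)) \<in> ?U2"
          using 2 by (intro image_eqI[of _ _ "(a, (c, d))"]) (auto simp: Z_def)
        then show False using 1 by blast
      qed
      then have "((a,c),(d,b)) \<in> ?C" using 2 \<open>c \<noteq> 0\<close> by (auto simp: F_def field_simps)
      then have "?h ((a,c),(d,b)) \<in> ?h ` ?C" by (rule imageI)
      then show False using 1 by simp
    qed
    then have "((a,b),(c,d)) \<in> ?U1"
      using 2 by (intro image_eqI[of _ _ "((a, b), d)"]) (auto simp: Z_def)
    then show False using 1 by blast
  qed
  have Zn: "card Z \<le> 2 * n" using card_mult_eq_0_le[OF S(1)] by (simp add: Z_def n_def)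
  have "card ?U1 \<le> card (Z \<times> S)" "card ?U2 \<le> card (S \<times> Z)" "card (?h ` ?C) \<le> card ?C"
    by (rule card_image_le, use fin finC S in simp)+
  moreover have "card (Z \<times> S) \<le> 2 * n * n" "card (S \<times> Z) \<le> 2 * n * n"
    using Zn by (simp_all add: card_cartesian_product n_def)
  moreover have "mult_energy S \<le> card (?U1 \<union> ?U2 \<union> ?h ` ?C)"
    unfolding mult_energy_def by (rule card_mono[OF _ sub]) (use fin finC S in auto)
  moreover have "card (?U1 \<union> ?U2 \<union> ?h ` ?C) \<le> card ?U1 + card ?U2 + card (?h ` ?C)"
    using card_Un_le[of "?U1 \<union> ?U2" "?h ` ?C"] card_Un_le[of ?U1 ?U2] by linarith
  ultimately have E1: "mult_energy S \<le> 4 * n\<^sup>2 + card ?C" by (simp add: power2_eq_square)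
  define P where "P = {s\<in>S. 0 < s}"
  define N where "N = {s\<in>uminus ` S. 0 < s}"
  define r1 where "r1 q = card {c \<in> P. q * c \<in> S}" for q
  define r2 where "r2 q = card {c \<in> N. q * c \<in> uminus ` S}" for q
  have "card ?C = (\<Sum>q\<in>Q. (card {x \<in> F. fst x / snd x = q})\<^sup>2)"
    by (rule card_collisions) (use fin in \<open>auto simp: Q_def\<close>)
  also have "\<dots> \<le> (\<Sum>q\<in>Q. (r1 q + r2 q)\<^sup>2)"
    using card_div_eq_le[OF S(1)]
    by (intro sum_mono power_mono) (auto simp: r1_def r2_def F_def P_def N_def)
  finally have "real (card ?C) \<le> real (\<Sum>q\<in>Q. (r1 q + r2 q)\<^sup>2)" by (rule of_nat_mono)
  also have "\<dots> = (\<Sum>q\<in>Q. (real (r1 q) + real (r2 q))\<^sup>2)" by simp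
  also have "\<dots> \<le> (\<Sum>q\<in>Q. 2 * (real (r1 q))\<^sup>2 + 2 * (real (r2 q))\<^sup>2)"
  proof (rule sum_mono)
    fix q
    show "(real (r1 q) + real (r2 q))\<^sup>2 \<le> 2 * (real (r1 q))\<^sup>2 + 2 * (real (r2 q))\<^sup>2"
      using sum_squares_bound[of "real (r1 q)" "real (r2 q)"] by (simp add: power2_sum)
  qed
  also have "\<dots> = 2 * real (\<Sum>q\<in>Q. (r1 q)\<^sup>2) + 2 * real (\<Sum>q\<in>Q. (r2 q)\<^sup>2)"
    by (simp add: sum.distrib sum_distrib_left)
  also have "\<dots> \<le> 2 * (4 * (real m)\<^sup>2 * (1 + ln (real n))) + 2 * (4 * (real m)\<^sup>2 * (1 + ln (real n)))"
  proof (intro add_mono mult_left_mono)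
    have "card (sumset P) \<le> m" "card P \<le> n" unfolding m_def n_def
      using S by (auto intro!: card_mono finite_sumset sumset_mono simp: P_def)
    then show "real (\<Sum>q\<in>Q. (r1 q)\<^sup>2) \<le> 4 * (real m)\<^sup>2 * (1 + ln (real n))"
      unfolding r1_def using S fin n
      by (intro sum_slopes_power2_le) (auto simp: P_def m_def)
    have "card (sumset N) \<le> card (sumset (uminus ` S))" "card N \<le> card (uminus ` S)"
      using S by (auto intro!: card_mono finite_sumset sumset_mono simp: N_def)
    then have "card (sumset N) \<le> m" "card N \<le> n"
      by (simp_all add: card_sumset_uminus m_def n_def card_image)
    then show "real (\<Sum>q\<in>Q. (r2 q)\<^sup>2) \<le> 4 * (real m)\<^sup>2 * (1 + ln (real n))"
      unfolding r2_def using S fin n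
      by (intro sum_slopes_power2_le) (auto simp: N_def m_def card_sumset_uminus)
  qed auto
  finally have E2: "real (card ?C) \<le> 16 * (real m)\<^sup>2 * (1 + ln (real n))" by (simp add: mult_ac)
  have l: "1/2 \<le> ln (2::real)" using ln2_ge_two_thirds by simp
  have l2: "ln (2 * real n) = ln 2 + ln (real n)" using n by (simp add: ln_mult)
  have l3: "0 \<le> ln (real n)" using n by simp
  \<comment> \<open>These absorb both the zero solutions and the 1 of the harmonic bound into the
    logarithm, whence the constant 40 = 2 * (4 + 16).\<close>
  have l4: "1 \<le> 2 * ln (2 * real n)" "1 + ln (real n) \<le> 2 * ln (2 * real n)"
    using l l2 l3 by linarith+
  have "real (mult_energy S) \<le> 4 * (real n)\<^sup>2 + real (card ?C)"
    using E1 of_nat_mono[OF E1, where 'a=real] by simp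
  also have "\<dots> \<le> 4 * ((real m)\<^sup>2 * (2 * ln (2 * real n))) + 16 * ((real m)\<^sup>2 * (2 * ln (2 * real n)))"
  proof -
    have "(real n)\<^sup>2 * 1 \<le> (real m)\<^sup>2 * (2 * ln (2 * real n))"
      using nm l4 by (intro mult_mono power_mono) auto
    moreover have "(real m)\<^sup>2 * (1 + ln (real n)) \<le> (real m)\<^sup>2 * (2 * ln (2 * real n))"
      using l4 by (intro mult_left_mono) auto
    ultimately show ?thesis using E2 by simp
  qed
  finally show ?thesis by (simp add: m_def n_def)
qed

section \<open>Linear algebra of commuting pairs\<close>

text \<open>On \<open>off i j (A, B)\<close> this is the determinant of the 2x2 matrix with rows
  (a_ij, b_ij) and (a_ji, b_ji). The entries are grouped as a difference of two products so that its
  level sets are counted by shifted collisions.\<close>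

definition qdet :: "(real \<times> real) \<times> (real \<times> real) \<Rightarrow> real" where
  "qdet q = fst (fst q) * snd (fst q) - fst (snd q) * snd (snd q)"

definition off :: "3 \<Rightarrow> 3 \<Rightarrow> (real^3^3) \<times> (real^3^3) \<Rightarrow> (real \<times> real) \<times> (real \<times> real)" where
  "off i j p = ((fst p $ i $ j, snd p $ j $ i), (snd p $ i $ j, fst p $ j $ i))"

definition dg :: "3 \<Rightarrow> (real^3^3) \<times> (real^3^3) \<Rightarrow> real \<times> real" where
  "dg i p = (fst p $ i $ i, snd p $ i $ i)"

definition commuting_pairs :: "real set \<Rightarrow> ((real^3^3) \<times> (real^3^3)) set" where
  "commuting_pairs S = {p. entries_in S (fst p) \<and> entries_in S (snd p) \<and> fst p ** snd p = snd p ** fst p}"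

text \<open>The coordinate of the \<open>j\<close>-th diagonal pair that determines the other one, once the \<open>i\<close>-th
  diagonal pair and all off-diagonal entries are known.\<close>
definition free_dg :: "3 \<Rightarrow> 3 \<Rightarrow> (real^3^3) \<times> (real^3^3) \<Rightarrow> real" where
  "free_dg i j p = (if snd p $ i $ j \<noteq> 0 \<or> snd p $ j $ i \<noteq> 0 then snd p $ j $ j else fst p $ j $ j)"

lemma off_mem: "p \<in> commuting_pairs S \<Longrightarrow> off i j p \<in> (S \<times> S) \<times> (S \<times> S)"
  by (auto simp: commuting_pairs_def off_def entries_in_def)

lemma dg_mem: "p \<in> commuting_pairs S \<Longrightarrow> dg i p \<in> S \<times> S"
  by (auto simp: commuting_pairs_def dg_def entries_in_def)

lemma free_dg_mem: "p \<in> commuting_pairs S \<Longrightarrow> free_dg i j p \<in> S"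
  by (auto simp: commuting_pairs_def free_dg_def entries_in_def)

text \<open>\<open>qdet\<close> is a difference of two values of the product map, so every level set
  is at most as large as the zero level, which is the energy.\<close>

lemma card_qdet_eq_le:
  assumes "finite S"
  shows "card {q \<in> (S \<times> S) \<times> (S \<times> S). qdet q = t} \<le> mult_energy S"
proof -
  have "{q \<in> (S \<times> S) \<times> (S \<times> S). qdet q = t}
    = {(x,y). x \<in> S \<times> S \<and> y \<in> S \<times> S \<and> (\<lambda>x. fst x * snd x) x - (\<lambda>x. fst x * snd x) y = t}"
    by (auto simp: qdet_def)
  then show ?thesis
    using card_shifted_collisions_le[of "S \<times> S" "\<lambda>x. fst x * snd x" t] assms
    by (simp add: mult_energy_def)
qed

text \<open>The first block is free, with n^4 choices; it fixes the level on which the other two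
  must lie.\<close>

lemma card_equal_qdets_le:
  assumes S: "finite S"
  defines "D \<equiv> (S \<times> S) \<times> (S \<times> S)"
  shows "card {(x,y,z). x \<in> D \<and> y \<in> D \<and> z \<in> D \<and> qdet x = qdet y \<and> qdet y = qdet z}
    \<le> card S ^ 4 * (mult_energy S)\<^sup>2"
proof -
  let ?C = "{(x,y,z). x \<in> D \<and> y \<in> D \<and> z \<in> D \<and> qdet x = qdet y \<and> qdet y = qdet z}"
  have fD: "finite D" using S by (simp add: D_def)
  have "card ?C \<le> card D * (mult_energy S)\<^sup>2"
  proof (rule card_le_fibers[where g=fst])
    show "finite ?C" by (rule finite_subset[of _ "D \<times> D \<times> D"]) (use fD in auto)
    fix x
    let ?Q = "{q \<in> D. qdet q = qdet x}"
    have "card {p \<in> ?C. fst p = x} \<le> card ({x} \<times> ?Q \<times> ?Q)"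
      by (rule card_mono) (use fD in auto)
    also have "\<dots> \<le> (mult_energy S)\<^sup>2"
      using card_qdet_eq_le[OF S, of "qdet x"]
      by (simp add: card_cartesian_product power2_eq_square mult_mono D_def)
    finally show "card {p \<in> ?C. fst p = x} \<le> (mult_energy S)\<^sup>2" .
  qed (use fD in auto)
  moreover have "card D = card S ^ 4" by (simp add: D_def card_cartesian_product numeral_eq_Suc)
  ultimately show ?thesis by simp
qed

text \<open>Arbitrary distinct indices replace 1, 2, 3 so that the later arguments can be reused
  under permutations of the indices.\<close>

lemma matrix_mult_entry:
  fixes A B :: "real^3^3"
  assumes "distinct [i, j, k]"
  shows "(A ** B) $ x $ y = A $ x $ i * B $ i $ y + A $ x $ j * B $ j $ y + A $ x $ k * B $ k $ y"
proof -
  have "(UNIV::3 set) = {i, j, k}"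
    by (rule sym, rule card_subset_eq) (use assms in auto)
  then have "(A ** B) $ x $ y = (\<Sum>l\<in>{i, j, k}. A $ x $ l * B $ l $ y)"
    by (simp add: matrix_matrix_mult_def)
  then show ?thesis using assms by (simp add: add.assoc)
qed

lemma commuting_pairs_entry:
  assumes "p \<in> commuting_pairs S" "distinct [i, j, k]"
  shows "fst p $ x $ i * snd p $ i $ y + fst p $ x $ j * snd p $ j $ y + fst p $ x $ k * snd p $ k $ y
    = snd p $ x $ i * fst p $ i $ y + snd p $ x $ j * fst p $ j $ y + snd p $ x $ k * fst p $ k $ y"
  using assms(1) unfolding commuting_pairs_def
  by (metis (mono_tags, lifting) matrix_mult_entry[OF assms(2)] mem_Collect_eq)

text \<open>In the (i,i) entry of AB = BA the terms a_ii b_ii cancel; what remains relates the two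
  blocks that meet index i.\<close>

lemma commuting_pairs_qdet_eq:
  assumes "p \<in> commuting_pairs S" "distinct [i, j, k]"
  shows "qdet (off i j p) = qdet (off k i p)"
  using commuting_pairs_entry[OF assms, of i i] by (simp add: qdet_def off_def algebra_simps)

text \<open>A block \<open>off i j\<close> records both the ij and the ji positions, so three cyclic
  blocks and three diagonal pairs exhaust all 18 entries.\<close>

lemma pair_eqI:
  assumes ijk: "distinct [i, j, k]"
    and "off i j p = off i j p'" "off j k p = off j k p'" "off k i p = off k i p'"
    and "dg i p = dg i p'" "dg j p = dg j p'" "dg k p = dg k p'"
  shows "p = p'"
proof -
  have "(UNIV::3 set) = {i, j, k}"
    by (rule sym, rule card_subset_eq) (use assms in auto)
  then have ex: "x = i \<or> x = j \<or> x = k" for x :: 3 by auto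
  have "fst p $ x $ y = fst p' $ x $ y \<and> snd p $ x $ y = snd p' $ x $ y" for x y
    using ex[of x] ex[of y] assms(2-) unfolding off_def dg_def prod.inject by (elim disjE) simp_all
  then show ?thesis by (simp add: prod_eq_iff vec_eq_iff)
qed

text \<open>Subtracting the \<open>(i,j)\<close> commutation equations of two pairs with the same off-diagonal part.\<close>
lemma diagonal_difference:
  assumes p: "p \<in> commuting_pairs S" "p' \<in> commuting_pairs S" and ijk: "distinct [i, j, k]"
    and eq: "off i j p = off i j p'" "off j k p = off j k p'" "off k i p = off k i p'" "dg i p = dg i p'"
  shows "(snd p $ j $ j - snd p' $ j $ j) * fst p $ i $ j = (fst p $ j $ j - fst p' $ j $ j) * snd p $ i $ j"
    "(snd p $ j $ j - snd p' $ j $ j) * fst p $ j $ i = (fst p $ j $ j - fst p' $ j $ j) * snd p $ j $ i"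
  using commuting_pairs_entry[OF p(1) ijk, of i j] commuting_pairs_entry[OF p(2) ijk, of i j]
    commuting_pairs_entry[OF p(1) ijk, of j i] commuting_pairs_entry[OF p(2) ijk, of j i] eq
  by (auto simp: off_def dg_def algebra_simps)

text \<open>The two equations of \<open>diagonal_difference\<close> form a homogeneous linear system
  in the differences X, Y of the j-th diagonal entries, with determinant
  \<open>qdet (off i j p)\<close> up to sign. The computation is Cramer's rule.\<close>

lemma dg_eq_if_qdet_nonzero:
  assumes p: "p \<in> commuting_pairs S" "p' \<in> commuting_pairs S" and ijk: "distinct [i, j, k]"
    and eq: "off i j p = off i j p'" "off j k p = off j k p'" "off k i p = off k i p'" "dg i p = dg i p'"
    and nz: "qdet (off i j p) \<noteq> 0"
  shows "dg j p = dg j p'"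
proof -
  note d = diagonal_difference[OF p ijk eq]
  define X where "X = fst p $ j $ j - fst p' $ j $ j"
  define Y where "Y = snd p $ j $ j - snd p' $ j $ j"
  have d: "Y * fst p $ i $ j = X * snd p $ i $ j" "Y * fst p $ j $ i = X * snd p $ j $ i"
    using d by (simp_all add: X_def Y_def)
  have "X * qdet (off i j p) = fst p $ i $ j * (X * snd p $ j $ i) - fst p $ j $ i * (X * snd p $ i $ j)"
    by (simp add: qdet_def off_def algebra_simps)
  also have "\<dots> = 0" unfolding d[symmetric] by simp
  finally have "X = 0" using nz by simp
  have "Y * qdet (off i j p) = snd p $ j $ i * (Y * fst p $ i $ j) - snd p $ i $ j * (Y * fst p $ j $ i)"
    by (simp add: qdet_def off_def algebra_simps)
  also have "\<dots> = 0" unfolding d by simp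
  finally have "Y = 0" using nz by simp
  with \<open>X = 0\<close> show ?thesis by (simp add: X_def Y_def dg_def)
qed

text \<open>A nonzero block leaves a nonzero coefficient in the linear system.
  \<open>free_dg\<close> fixes one unknown, chosen so that the other is the one multiplied by that
  coefficient.\<close>

lemma dg_eq_if_free_dg_eq:
  assumes p: "p \<in> commuting_pairs S" "p' \<in> commuting_pairs S" and ijk: "distinct [i, j, k]"
    and eq: "off i j p = off i j p'" "off j k p = off j k p'" "off k i p = off k i p'" "dg i p = dg i p'"
    and nz: "off i j p \<noteq> 0" and free: "free_dg i j p = free_dg i j p'"
  shows "dg j p = dg j p'"
proof -
  note d = diagonal_difference[OF p ijk eq]
  have s: "snd p' $ i $ j = snd p $ i $ j" "snd p' $ j $ i = snd p $ j $ i"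
    using eq by (simp_all add: off_def)
  show ?thesis
  proof (cases "snd p $ i $ j \<noteq> 0 \<or> snd p $ j $ i \<noteq> 0")
    case True
    then have "snd p $ j $ j = snd p' $ j $ j" using free s by (simp add: free_dg_def)
    then show ?thesis using d True by (auto simp: dg_def)
  next
    case False
    then have "fst p $ j $ j = fst p' $ j $ j" using free s by (simp add: free_dg_def)
    moreover have "fst p $ i $ j \<noteq> 0 \<or> fst p $ j $ i \<noteq> 0"
      using nz False by (auto simp: off_def zero_prod_def)
    ultimately show ?thesis using d by (auto simp: dg_def)
  qed
qed

section \<open>Counting commuting pairs by their off-diagonal part\<close>

lemma off_swap_eq_iff: "off i j p = off i j p' \<longleftrightarrow> off j i p = off j i p'"
  by (auto simp: off_def)

lemma off_swap_eq_0_iff: "off i j p = 0 \<longleftrightarrow> off j i p = 0"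
  by (auto simp: off_def zero_prod_def)

lemma qdet_off_swap: "qdet (off j i p) = - qdet (off i j p)"
  by (simp add: off_def qdet_def)

text \<open>The blocks and the i-th diagonal pair determine the rest. Blocks number at most n^4 E^2
  because their determinants agree, and the diagonal pair adds n^2.\<close>

lemma card_qdet_nonzero_le:
  assumes S: "finite S" and ijk: "distinct [i, j, k]"
  shows "finite {p \<in> commuting_pairs S. qdet (off i j p) \<noteq> 0}"
    "card {p \<in> commuting_pairs S. qdet (off i j p) \<noteq> 0} \<le> card S ^ 6 * (mult_energy S)\<^sup>2"
proof -
  define D where "D = (S \<times> S) \<times> (S \<times> S)"
  define T where "T = {(x,y,z). x \<in> D \<and> y \<in> D \<and> z \<in> D \<and> qdet x = qdet y \<and> qdet y = qdet z}"
  define h where "h p = ((off i j p, off j k p, off k i p), dg i p)" for p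
  let ?P = "{p \<in> commuting_pairs S. qdet (off i j p) \<noteq> 0}"
  have q: "qdet (off i j p) = qdet (off j k p)" "qdet (off j k p) = qdet (off k i p)"
    if "p \<in> commuting_pairs S" for p
    using commuting_pairs_qdet_eq[OF that, of j k i] commuting_pairs_qdet_eq[OF that ijk] ijk by auto
  have inj: "inj_on h ?P"
  proof (rule inj_onI)
    fix p p' assume "p \<in> ?P" "p' \<in> ?P" and h: "h p = h p'"
    then have p: "p \<in> commuting_pairs S" "p' \<in> commuting_pairs S" "qdet (off i j p) \<noteq> 0" by auto
    have e: "off i j p = off i j p'" "off j k p = off j k p'" "off k i p = off k i p'" "dg i p = dg i p'"
      using h by (auto simp: h_def)
    have "dg j p = dg j p'" by (rule dg_eq_if_qdet_nonzero[OF p(1,2) ijk e p(3)])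
    moreover have "dg k p = dg k p'"
    \<comment> \<open>The roles of j and k are exchanged; reversing a block only changes the sign of
      its determinant.\<close>
    proof (rule dg_eq_if_qdet_nonzero[OF p(1,2), of i k j])
      show "qdet (off i k p) \<noteq> 0" using p(3) q[OF p(1)] qdet_off_swap[of k i p] by simp
    qed (use ijk e off_swap_eq_iff in auto)
    ultimately show "p = p'" using pair_eqI[OF ijk] e by blast
  qed
  have sub: "h ` ?P \<subseteq> T \<times> (S \<times> S)"
  proof (rule image_subsetI)
    fix p assume "p \<in> ?P"
    then have c: "p \<in> commuting_pairs S" by simp
    show "h p \<in> T \<times> (S \<times> S)"
      unfolding h_def T_def D_def using off_mem[OF c] dg_mem[OF c] q[OF c] by simp
  qed
  have fin: "finite (T \<times> (S \<times> S))"
    by (rule finite_subset[of _ "(D \<times> D \<times> D) \<times> (S \<times> S)"]) (use S in \<open>auto simp: T_def D_def\<close>)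
  show "finite ?P" by (rule inj_on_finite[OF inj sub fin])
  have "card ?P \<le> card (T \<times> (S \<times> S))" by (rule card_inj_on_le[OF inj sub fin])
  also have "\<dots> = card T * (card S)\<^sup>2" by (simp add: card_cartesian_product power2_eq_square)
  also have "\<dots> \<le> (card S ^ 4 * (mult_energy S)\<^sup>2) * (card S)\<^sup>2"
    using card_equal_qdets_le[OF S] by (intro mult_right_mono) (auto simp: T_def D_def)
  also have "\<dots> = card S ^ 6 * (mult_energy S)\<^sup>2"
    by (simp add: power_add[symmetric] mult.commute mult.left_commute)
  finally show "card ?P \<le> card S ^ 6 * (mult_energy S)\<^sup>2" .
qed

text \<open>Both blocks meeting index i are nonzero, so one coordinate of each of the j-th and k-th
  diagonal pairs suffices. With the i-th pair this gives n^4 diagonals, and each of the three blocks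
  has at most E values.\<close>

lemma card_qdet_zero_le:
  assumes S: "finite S" and ijk: "distinct [i, j, k]"
  defines "P \<equiv> {p \<in> commuting_pairs S. qdet (off i j p) = 0 \<and> off i j p \<noteq> 0 \<and> off k i p \<noteq> 0}"
  shows "finite P" "card P \<le> card S ^ 4 * (mult_energy S)^3"
proof -
  define D where "D = {q \<in> (S \<times> S) \<times> (S \<times> S). qdet q = 0}"
  define h where "h p = ((off i j p, off j k p, off k i p), dg i p, free_dg i j p, free_dg i k p)" for p
  have q: "qdet (off i j p) = qdet (off j k p)" "qdet (off j k p) = qdet (off k i p)"
    if "p \<in> commuting_pairs S" for p
    using commuting_pairs_qdet_eq[OF that, of j k i] commuting_pairs_qdet_eq[OF that ijk] ijk by auto
  have inj: "inj_on h P"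
  proof (rule inj_onI)
    fix p p' assume "p \<in> P" "p' \<in> P" and h: "h p = h p'"
    then have p: "p \<in> commuting_pairs S" "p' \<in> commuting_pairs S" "off i j p \<noteq> 0" "off k i p \<noteq> 0"
      by (auto simp: P_def)
    have e: "off i j p = off i j p'" "off j k p = off j k p'" "off k i p = off k i p'" "dg i p = dg i p'"
      and f: "free_dg i j p = free_dg i j p'" "free_dg i k p = free_dg i k p'"
      using h by (auto simp: h_def)
    have "dg j p = dg j p'" by (rule dg_eq_if_free_dg_eq[OF p(1,2) ijk e p(3) f(1)])
    moreover have "dg k p = dg k p'"
    proof (rule dg_eq_if_free_dg_eq[OF p(1,2), of i k j])
      show "off i k p \<noteq> 0" using p(4) off_swap_eq_0_iff by blast
    qed (use ijk e f off_swap_eq_iff in auto)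
    ultimately show "p = p'" using pair_eqI[OF ijk] e by blast
  qed
  have sub: "h ` P \<subseteq> (D \<times> D \<times> D) \<times> (S \<times> S) \<times> S \<times> S"
  proof (rule image_subsetI)
    fix p assume p: "p \<in> P"
    then have c: "p \<in> commuting_pairs S" and 0: "qdet (off i j p) = 0" by (auto simp: P_def)
    show "h p \<in> (D \<times> D \<times> D) \<times> (S \<times> S) \<times> S \<times> S"
      unfolding h_def D_def using off_mem[OF c] dg_mem[OF c] free_dg_mem[OF c] q[OF c] 0 by simp
  qed
  have fin: "finite ((D \<times> D \<times> D) \<times> (S \<times> S) \<times> S \<times> S)" using S by (simp add: D_def)
  show "finite P" by (rule inj_on_finite[OF inj sub fin])
  have "card P \<le> card ((D \<times> D \<times> D) \<times> (S \<times> S) \<times> S \<times> S)" by (rule card_inj_on_le[OF inj sub fin])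
  also have "\<dots> = card S ^ 4 * card D ^ 3" by (simp add: card_cartesian_product numeral_eq_Suc)
  also have "\<dots> \<le> card S ^ 4 * (mult_energy S) ^ 3"
    using card_qdet_eq_le[OF S, of 0] by (intro mult_left_mono power_mono) (auto simp: D_def)
  finally show "card P \<le> card S ^ 4 * (mult_energy S)^3" .
qed

text \<open>Four entries of the remaining block and six diagonal entries give the exponent
  10.\<close>

lemma card_two_off_zero_le:
  assumes S: "finite S" and ijk: "distinct [i, j, k]"
  defines "P \<equiv> {p \<in> commuting_pairs S. off i j p = 0 \<and> off k i p = 0}"
  shows "finite P" "card P \<le> card S ^ 10"
proof -
  define h where "h p = (off j k p, dg i p, dg j p, dg k p)" for p
  have inj: "inj_on h P"
    by (rule inj_onI) (rule pair_eqI[OF ijk], auto simp: P_def h_def)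
  have sub: "h ` P \<subseteq> ((S \<times> S) \<times> (S \<times> S)) \<times> (S \<times> S) \<times> (S \<times> S) \<times> (S \<times> S)"
  proof (rule image_subsetI)
    fix p assume "p \<in> P"
    then have c: "p \<in> commuting_pairs S" by (auto simp: P_def)
    show "h p \<in> ((S \<times> S) \<times> (S \<times> S)) \<times> (S \<times> S) \<times> (S \<times> S) \<times> (S \<times> S)"
      unfolding h_def using off_mem[OF c] dg_mem[OF c] by simp
  qed
  have fin: "finite (((S \<times> S) \<times> (S \<times> S)) \<times> (S \<times> S) \<times> (S \<times> S) \<times> (S \<times> S))" using S by simp
  show "finite P" by (rule inj_on_finite[OF inj sub fin])
  have "card P \<le> card (((S \<times> S) \<times> (S \<times> S)) \<times> (S \<times> S) \<times> (S \<times> S) \<times> (S \<times> S))"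
    by (rule card_inj_on_le[OF inj sub fin])
  also have "\<dots> = card S ^ 10" by (simp add: card_cartesian_product numeral_eq_Suc)
  finally show "card P \<le> card S ^ 10" .
qed

text \<open>When the common determinant is zero, two of the three blocks are both zero or both
  nonzero by pigeonhole, and any two blocks share an index. The three choices of that index give the
  factors 3. Finiteness is recorded for the cardinality comparison in the lower bound.\<close>

lemma C3_le_mult_energy:
  assumes S: "finite S"
  shows "finite (commuting_pairs S)"
    "C3 S \<le> card S ^ 6 * (mult_energy S)\<^sup>2 + 3 * (card S ^ 4 * (mult_energy S)^3) + 3 * card S ^ 10"
proof -
  define A where "A = {p \<in> commuting_pairs S. qdet (off 1 2 p) \<noteq> 0}"
  define G where "G i j k = {p \<in> commuting_pairs S. qdet (off i j p) = 0 \<and> off i j p \<noteq> 0 \<and> off k i p \<noteq> 0}" for i j k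
  define Z where "Z i j k = {p \<in> commuting_pairs S. off i j p = 0 \<and> off k i p = 0}" for i j k
  have d: "distinct [1,2,3::3]" "distinct [2,3,1::3]" "distinct [3,1,2::3]" by auto
  note A = card_qdet_nonzero_le[OF S d(1), folded A_def]
  note G = card_qdet_zero_le[OF S, folded G_def]
  note Z = card_two_off_zero_le[OF S, folded Z_def]
  let ?U = "A \<union> (G 1 2 3 \<union> (G 2 3 1 \<union> G 3 1 2)) \<union> (Z 1 2 3 \<union> (Z 2 3 1 \<union> Z 3 1 2))"
  have sub: "commuting_pairs S \<subseteq> ?U"
  proof
    fix p assume p: "p \<in> commuting_pairs S"
    have "qdet (off 1 2 p) = qdet (off 3 1 p)" "qdet (off 2 3 p) = qdet (off 1 2 p)"
      using commuting_pairs_qdet_eq[OF p d(1)] commuting_pairs_qdet_eq[OF p d(2)] by auto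
    then show "p \<in> ?U" using p by (auto simp: A_def G_def Z_def)
  qed
  have finU: "finite ?U" using A(1) G(1) Z(1) d by blast
  then show "finite (commuting_pairs S)" using sub finite_subset by blast
  have "C3 S = card (commuting_pairs S)" by (simp add: C3_def commuting_pairs_def)
  also have "\<dots> \<le> card ?U" by (rule card_mono[OF finU sub])
  also have "\<dots> \<le> card A + (card (G 1 2 3) + (card (G 2 3 1) + card (G 3 1 2)))
      + (card (Z 1 2 3) + (card (Z 2 3 1) + card (Z 3 1 2)))"
    by (intro order_trans[OF card_Un_le] add_mono order_refl)
  finally show "C3 S \<le> card S ^ 6 * (mult_energy S)\<^sup>2 + 3 * (card S ^ 4 * (mult_energy S)^3) + 3 * card S ^ 10"
    using A(2) G(2)[OF d(1)] G(2)[OF d(2)] G(2)[OF d(3)] Z(2)[OF d(1)] Z(2)[OF d(2)] Z(2)[OF d(3)]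
    by linarith
qed

section \<open>Lower bound through equal differences\<close>

lemma card_equal_differences_ge:
  fixes S :: "real set"
  assumes S: "finite S"
  defines "f \<equiv> (\<lambda>x. snd x - fst x)"
  shows "real (card S) ^ 6 \<le> (real (card (sumset S)))\<^sup>2
    * real (card {(x,y,z). x \<in> S \<times> S \<and> y \<in> S \<times> S \<and> z \<in> S \<times> S \<and> f x = f y \<and> f y = f z})"
    (is "_ \<le> _ * real (card ?W)")
proof (cases "S = {}")
  case False
  define n where "n = card S"
  define m where "m = card (sumset S)"
  have n: "0 < n" using S False by (simp add: n_def card_gt_0_iff)
  define s where "s v = card {x \<in> S \<times> S. fst x + snd x = v}" for v
  define r where "r v = card {x \<in> S \<times> S. f x = v}" for v
  define V where "V = f ` (S \<times> S)"
  have fin: "finite (S \<times> S)" "finite V" "finite (sumset S)" using S finite_sumset by (auto simp: V_def)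
  let ?C = "{(x,y). x \<in> S \<times> S \<and> y \<in> S \<times> S \<and> f x = f y}"
  let ?D = "{(x,y). x \<in> S \<times> S \<and> y \<in> S \<times> S \<and> fst x + snd x = fst y + snd y}"
  define E where "E = card ?C"
  have n2: "card (S \<times> S) = n\<^sup>2" by (simp add: card_cartesian_product n_def power2_eq_square)
  \<comment> \<open>Rewriting a + b = c + d as b - c = d - a turns collisions of sums into
    collisions of differences.\<close>
  have "inj_on (\<lambda>((a,b),(c,d)). ((c,b),(a,d))) ?D" by (auto simp: inj_on_def)
  moreover have "(\<lambda>((a,b),(c,d)). ((c,b),(a,d))) ` ?D \<subseteq> ?C" by (auto simp: f_def algebra_simps)
  moreover have "finite ?C" by (rule finite_subset[of _ "(S \<times> S) \<times> (S \<times> S)"]) (use fin in auto)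
  ultimately have DE: "card ?D \<le> E" unfolding E_def by (rule card_inj_on_le)
  have D: "card ?D = (\<Sum>v\<in>sumset S. (s v)\<^sup>2)"
    unfolding s_def by (rule card_collisions) (use fin in \<open>auto intro: add_mem_sumset\<close>)
  have "card (S \<times> S) = (\<Sum>v\<in>sumset S. s v)"
    unfolding s_def by (rule card_eq_sum_fibers) (use fin in \<open>auto intro: add_mem_sumset\<close>)
  then have "(real n)\<^sup>2 = (\<Sum>v\<in>sumset S. 1 * real (s v))"
    using n2 by (metis (mono_tags, lifting) mult_1 of_nat_power of_nat_sum sum.cong)
  then have "((real n)\<^sup>2)\<^sup>2 \<le> (\<Sum>v\<in>sumset S. 1\<^sup>2) * (\<Sum>v\<in>sumset S. (real (s v))\<^sup>2)"
    using Cauchy_Schwarz_ineq_sum[of "\<lambda>_. 1" "\<lambda>v. real (s v)" "sumset S"] by simp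
  also have "\<dots> = real m * real (card ?D)" by (simp add: D m_def)
  also have "\<dots> \<le> real m * real E" using DE by (simp add: mult_left_mono)
  finally have 1: "(real n)^4 \<le> real m * real E" by simp
  have EV: "E = (\<Sum>v\<in>V. (r v)\<^sup>2)"
    unfolding E_def r_def by (rule card_collisions) (use fin in \<open>auto simp: V_def\<close>)
  have WV: "card ?W = (\<Sum>v\<in>V. r v ^ 3)"
    unfolding r_def by (rule card_triple_collisions) (use fin in \<open>auto simp: V_def\<close>)
  have NV: "n\<^sup>2 = (\<Sum>v\<in>V. r v)"
    unfolding n2[symmetric] r_def by (rule card_eq_sum_fibers) (use fin in \<open>auto simp: V_def\<close>)
  have sq: "sqrt (real k) * (real k * sqrt (real k)) = (real k)\<^sup>2" 
     "(real k * sqrt (real k))\<^sup>2 = real k ^ 3" for k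
    by (simp_all add: power2_eq_square power3_eq_cube)
  \<comment> \<open>Splitting r^2 = r^(1/2) * r^(3/2) lets Cauchy-Schwarz interpolate the second
    moment between the first and the third.\<close>
  have "(real E)\<^sup>2 = (\<Sum>v\<in>V. sqrt (real (r v)) * (real (r v) * sqrt (real (r v))))\<^sup>2"
    by (simp add: EV sq)
  also have "\<dots> \<le> (\<Sum>v\<in>V. (sqrt (real (r v)))\<^sup>2) * (\<Sum>v\<in>V. (real (r v) * sqrt (real (r v)))\<^sup>2)"
    by (rule Cauchy_Schwarz_ineq_sum)
  also have "\<dots> = real (n\<^sup>2) * real (card ?W)"
    unfolding NV WV by (simp add: sq)
  finally have 2: "(real E)\<^sup>2 \<le> (real n)\<^sup>2 * real (card ?W)" by simp
  have "(real n)\<^sup>2 * (real n)^6 = ((real n)^4)\<^sup>2" by simp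
  also have "\<dots> \<le> (real m * real E)\<^sup>2" using 1 by (intro power_mono) auto
  also have "\<dots> \<le> (real m)\<^sup>2 * ((real n)\<^sup>2 * real (card ?W))"
    using 2 by (simp add: power_mult_distrib mult_left_mono)
  also have "\<dots> = (real n)\<^sup>2 * ((real m)\<^sup>2 * real (card ?W))" by simp
  finally have "(real n)^6 \<le> (real m)\<^sup>2 * real (card ?W)"
    using n by (subst (asm) mult_le_cancel_left_pos) auto
  then show ?thesis by (simp add: n_def m_def)
qed simp

text \<open>The pairs counted are \<open>(A, A + t I)\<close>.\<close>
lemma C3_ge_equal_differences:
  fixes S :: "real set"
  assumes S: "finite S"
  defines "f \<equiv> (\<lambda>x. snd x - fst x)"
  shows "card S ^ 6 * card {(x,y,z). x \<in> S \<times> S \<and> y \<in> S \<times> S \<and> z \<in> S \<times> S \<and> f x = f y \<and> f y = f z} \<le> C3 S"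
proof -
  let ?W = "{(x,y,z). x \<in> S \<times> S \<and> y \<in> S \<times> S \<and> z \<in> S \<times> S \<and> f x = f y \<and> f y = f z}"
  define M :: "real \<Rightarrow> real \<Rightarrow> real \<Rightarrow> real \<times> real \<times> real \<times> real \<times> real \<times> real \<Rightarrow> real^3^3" where
    "M x y z = (\<lambda>(a,b,c,d,e,g). vector [vector [x,a,b], vector [c,y,d], vector [e,g,z]])" for x y z
  \<comment> \<open>Both matrices share the off-diagonal entries \<open>w\<close>; equal differences
    on the diagonal make them differ by a scalar matrix.\<close>
  define h where "h = (\<lambda>(w, (x,x'), (y,y'), (z,z')). (M x y z w, M x' y' z' w))"
  have "card ((S \<times> S \<times> S \<times> S \<times> S \<times> S) \<times> ?W) \<le> card (commuting_pairs S)"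
  proof (rule card_inj_on_le)
    show "inj_on h ((S \<times> S \<times> S \<times> S \<times> S \<times> S) \<times> ?W)"
      by (rule inj_onI) (auto simp: h_def M_def vec_eq_iff forall_3)
    show "h ` ((S \<times> S \<times> S \<times> S \<times> S \<times> S) \<times> ?W) \<subseteq> commuting_pairs S"
    proof (rule image_subsetI)
      fix p assume "p \<in> (S \<times> S \<times> S \<times> S \<times> S \<times> S) \<times> ?W"
      then obtain a b c d e g x x' y y' z z' where p: "p = ((a,b,c,d,e,g), (x,x'), (y,y'), (z,z'))"
        and S: "{a,b,c,d,e,g,x,x',y,y',z,z'} \<subseteq> S" and eq: "x' - x = y' - y" "y' - y = z' - z"
        by (auto simp: f_def)
      define t where "t = x' - x"
      have t: "x' = x + t" "y' = y + t" "z' = z + t" using eq by (simp_all add: t_def)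
      show "h p \<in> commuting_pairs S"
        using S unfolding p h_def M_def commuting_pairs_def t entries_in_def
        by (simp add: forall_3 vec_eq_iff matrix_matrix_mult_def sum_3 algebra_simps)
    qed
  qed (rule C3_le_mult_energy(1)[OF S])
  then show ?thesis
    by (simp add: card_cartesian_product C3_def commuting_pairs_def numeral_eq_Suc mult.assoc)
qed

section \<open>Assembling the two bounds\<close>

theorem theorem1p6:
  shows "\<exists>c1 c2 :: real. c1 > 0 \<and> c2 > 0 \<and>
    (\<forall>S :: real set. finite S \<longrightarrow> S \<noteq> {} \<longrightarrow>
      (let K = real (card (sumset S)) / real (card S) in
        c1 * K powr (-3) * real (card S) ^ 10 \<le> real (C3 S) \<and>
        real (C3 S) \<le> c2 * K ^ 6 * real (card S) ^ 10 * (ln (2 * real (card S))) ^ 3))"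
proof -
  have "1 * K powr (-3) * real (card S) ^ 10 \<le> real (C3 S) \<and>
      real (C3 S) \<le> 200000 * K ^ 6 * real (card S) ^ 10 * (ln (2 * real (card S))) ^ 3"
    if S: "finite S" "S \<noteq> {}" and K: "K = real (card (sumset S)) / real (card S)" for S K
  proof
    define n where "n = real (card S)"
    define m where "m = real (card (sumset S))"
    define L where "L = ln (2 * n)"
    define E where "E = real (mult_energy S)"
    have n: "1 \<le> n" using S by (simp add: n_def card_gt_0_iff Suc_leI)
    have K1: "1 \<le> K" using card_le_card_sumset[OF S(1)] n by (simp add: K n_def)
    have m: "m = K * n" using n by (simp add: K n_def m_def)
    have l: "1 \<le> 2 * L"
    proof -
      have "ln 2 \<le> L" using n by (simp add: L_def)
      then show ?thesis using ln2_ge_two_thirds by linarith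
    qed
    define W where "W = real (card {(x,y,z). x \<in> S \<times> S \<and> y \<in> S \<times> S \<and> z \<in> S \<times> S
      \<and> snd x - fst x = snd y - fst y \<and> snd y - fst y = snd z - fst z})"
    have W1: "n ^ 6 \<le> m\<^sup>2 * W"
      using card_equal_differences_ge[OF S(1)] by (simp add: n_def m_def W_def)
    have W2: "n ^ 6 * W \<le> real (C3 S)"
      using of_nat_mono[OF C3_ge_equal_differences[OF S(1)], where 'a=real]
      by (simp add: n_def W_def)
    have "n\<^sup>2 * n ^ 4 \<le> n\<^sup>2 * (K\<^sup>2 * W)"
      using W1 by (simp add: m power_mult_distrib mult_ac flip: power_add)
    then have "n ^ 4 \<le> K\<^sup>2 * W" using n by (subst (asm) mult_le_cancel_left_pos) auto
    \<comment> \<open>The count gives the exponent 2; since K \<ge> 1 it may be weakened to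
      3.\<close>
    also have "\<dots> \<le> K ^ 3 * W"
      using K1 by (intro mult_right_mono power_increasing) (auto simp: W_def)
    finally have "n ^ 6 * n ^ 4 \<le> n ^ 6 * (K ^ 3 * W)" using n by (intro mult_left_mono) auto
    also have "\<dots> \<le> K ^ 3 * real (C3 S)"
      using W2 K1 by (simp add: mult.left_commute mult_left_mono)
    finally have "n ^ 10 \<le> K ^ 3 * real (C3 S)" by (simp flip: power_add)
    then have "n ^ 10 / K ^ 3 \<le> real (C3 S)"
      using K1 by (simp add: divide_le_eq mult.commute)
    moreover have "K powr (-3) = 1 / K ^ 3"
      using K1 by (simp add: powr_minus_divide powr_numeral)
    ultimately show "1 * K powr (-3) * real (card S) ^ 10 \<le> real (C3 S)"
      by (simp add: n_def)
    \<comment> \<open>\<open>T\<close> is a common scale: E \<le> 40T and n^2 \<le> 2T, so each of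
      the three terms of the upper bound becomes a multiple of n^4 T^3.\<close>
    define T where "T = K\<^sup>2 * n\<^sup>2 * L"
    have T0: "0 \<le> T" using l by (simp add: T_def)
    have ET: "E \<le> 40 * T"
      using mult_energy_le[OF S] m by (simp add: E_def T_def n_def m_def L_def power_mult_distrib mult_ac)
    have "n\<^sup>2 * 1 \<le> n\<^sup>2 * (K\<^sup>2 * (2 * L))"
      using l mult_mono[of 1 "K\<^sup>2" 1 "2 * L"] K1 by (intro mult_left_mono) auto
    then have nT: "n\<^sup>2 \<le> 2 * T" by (simp add: T_def mult_ac)
    have "real (C3 S) \<le> n ^ 6 * E\<^sup>2 + 3 * (n ^ 4 * E ^ 3) + 3 * n ^ 10"
      using of_nat_mono[OF C3_le_mult_energy(2)[OF S(1)], where 'a=real] by (simp add: n_def E_def)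
    also have "n ^ 6 * E\<^sup>2 = n ^ 4 * (n\<^sup>2 * E\<^sup>2)" by simp
    also have "n ^ 10 = n ^ 4 * (n\<^sup>2) ^ 3" by simp
    also have "n ^ 4 * (n\<^sup>2 * E\<^sup>2) + 3 * (n ^ 4 * E ^ 3) + 3 * (n ^ 4 * (n\<^sup>2) ^ 3)
      \<le> n ^ 4 * ((2 * T) * (40 * T)\<^sup>2) + 3 * (n ^ 4 * (40 * T) ^ 3) + 3 * (n ^ 4 * (2 * T) ^ 3)"
      using ET nT T0 n by (intro add_mono mult_left_mono mult_mono power_mono) (auto simp: E_def)
    \<comment> \<open>195224 = 2 * 40^2 + 3 * 40^3 + 3 * 2^3, rounded up to 200000 next.\<close>
    also have "\<dots> = 195224 * (n ^ 4 * T ^ 3)" by (simp add: power2_eq_square power3_eq_cube)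
    also have "\<dots> \<le> 200000 * (n ^ 4 * T ^ 3)" using T0 n by (intro mult_right_mono) auto
    also have "\<dots> = 200000 * K ^ 6 * n ^ 10 * L ^ 3"
      by (simp add: T_def power_mult_distrib mult_ac flip: power_add power_mult)
    finally show "real (C3 S) \<le> 200000 * K ^ 6 * real (card S) ^ 10 * (ln (2 * real (card S))) ^ 3"
      by (simp add: n_def L_def)
  qed
  then show ?thesis
    unfolding Let_def by (intro exI[of _ 1] exI[of _ 200000]) auto
qed

end
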